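(* There is an absolute constant $c>0$ such that the following holds. Let $H$ be a bipartite graph on $h$ vertices. Then there exists $n_0=n_0(H)$ such that for every $n\geq n_0$, every graph $G$ on $n$ vertices which contains no induced copy of $H$ contains either an independent set of size at least $n^{c/h}$ or a (not necessarily induced) complete bipartite subgraph $K_{m,m}$ with $m\geq n^{c/h}$. *)

theory Defs
  imports Complex_Main
begin

definition simple_graph :: "'a set \<Rightarrow> ('a \<Rightarrow> 'a \<Rightarrow> bool) \<Rightarrow> bool" where
  "simple_graph V E \<longleftrightarrow> finite V \<and>
     (\<forall>x\<in>V. \<forall>y\<in>V. E x y \<longrightarrow> E y x) \<and> (\<forall>x\<in>V. \<not> E x x)"

definition independent_set :: "'a set \<Rightarrow> ('a \<Rightarrow> 'a \<Rightarrow> bool) \<Rightarrow> 'a set \<Rightarrow> bool" where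
  "independent_set V E I \<longleftrightarrow> I \<subseteq> V \<and> (\<forall>x\<in>I. \<forall>y\<in>I. \<not> E x y)"

definition bipartite :: "'a set \<Rightarrow> ('a \<Rightarrow> 'a \<Rightarrow> bool) \<Rightarrow> bool" where
  "bipartite V E \<longleftrightarrow> (\<exists>X Y. X \<union> Y = V \<and> X \<inter> Y = {} \<and>
      independent_set V E X \<and> independent_set V E Y)"

definition contains_induced :: "'b set \<Rightarrow> ('b \<Rightarrow> 'b \<Rightarrow> bool) \<Rightarrow> 'a set \<Rightarrow> ('a \<Rightarrow> 'a \<Rightarrow> bool) \<Rightarrow> bool" where
  "contains_induced W F V E \<longleftrightarrow> (\<exists>f. inj_on f W \<and> f ` W \<subseteq> V \<and>
      (\<forall>x\<in>W. \<forall>y\<in>W. E (f x) (f y) \<longleftrightarrow> F x y))"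

definition contains_Kmm :: "'a set \<Rightarrow> ('a \<Rightarrow> 'a \<Rightarrow> bool) \<Rightarrow> nat \<Rightarrow> bool" where
  "contains_Kmm V E m \<longleftrightarrow> (\<exists>A B. A \<subseteq> V \<and> B \<subseteq> V \<and> A \<inter> B = {} \<and>
      card A = m \<and> card B = m \<and> (\<forall>a\<in>A. \<forall>b\<in>B. E a b))"

end

theory Submission
  imports Defs
begin

text \<open>
  Let \<open>t\<close> be about \<open>n powr (c / h)\<close> and suppose that there is neither an independent set of size
  \<open>t\<close> nor a \<open>K\<^sub>t\<^sub>t\<close>. The first assumption forces many vertices of degree at least about \<open>n / t\<close>,
  so dependent random choice gives a set \<open>U\<close> of size \<open>n powr (1 - O(c))\<close> in which any \<open>h\<close> vertices
  have very many common neighbours. The second assumption says that for every large \<open>B\<close> all but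
  fewer than \<open>t\<close> vertices miss a \<open>1 / (4 t)\<close> fraction of \<open>B\<close>.

  The part \<open>X\<close> of \<open>H\<close> is embedded as an independent tuple in \<open>U\<close>. For a vertex \<open>j\<close> of the other
  part, start from the common neighbourhood of the images of the neighbours of \<open>j\<close> and discard
  the neighbourhoods of the remaining images one at a time. A step is spoiled only if the image
  in question is one of fewer than \<open>t\<close> vertices determined by the other entries of the tuple, so if
  \<open>N k\<close> counts the independent \<open>k\<close>-tuples in \<open>U\<close>, at most \<open>h\<^sup>2 t N (k - 1)\<close> of them are spoiled.
  A direct comparison with \<open>N h\<close> would lose a factor \<open>t powr (h\<^sup>2)\<close>, which is too much; but
  \<open>N (2 h)\<close> is so large that \<open>N k > h\<^sup>2 t N (k - 1)\<close> for some \<open>k\<close> between \<open>h\<close> and \<open>2 h\<close>, and the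
  surplus entries of a good \<open>k\<close>-tuple are ignored. The other part is then embedded greedily.
\<close>

section \<open>Independent tuples, common neighbourhoods and candidate sets\<close>

definition avoid :: "('a \<Rightarrow> 'a \<Rightarrow> bool) \<Rightarrow> 'a set \<Rightarrow> 'a \<Rightarrow> 'a set" where
  "avoid E B v = {u\<in>B. u \<noteq> v \<and> \<not> E v u}"

text \<open>Ordered tuples rather than sets, because entry \<open>i\<close> later serves as the
  image of the vertex \<open>i\<close> of \<open>H\<close> when \<open>i\<close> lies in the part
  \<open>X\<close>.\<close>

definition indep_lists :: "('a \<Rightarrow> 'a \<Rightarrow> bool) \<Rightarrow> 'a set \<Rightarrow> nat \<Rightarrow> 'a list set" where
  "indep_lists E A k = {xs. length xs = k \<and> set xs \<subseteq> A \<and> distinct xs \<and>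
      (\<forall>x\<in>set xs. \<forall>y\<in>set xs. \<not> E x y)}"

definition common_nbrs :: "'a set \<Rightarrow> ('a \<Rightarrow> 'a \<Rightarrow> bool) \<Rightarrow> 'a set \<Rightarrow> 'a set" where
  "common_nbrs V E S = {u\<in>V. \<forall>x\<in>S. E x u}"

text \<open>
  The vertices \<open>u\<close> that are still admissible for a vertex of \<open>H\<close> with neighbours \<open>S\<close> and
  non-neighbours \<open>S'\<close>, when only the non-neighbours with index below \<open>p\<close> have been respected.
\<close>

definition candidates ::
  "'a set \<Rightarrow> ('a \<Rightarrow> 'a \<Rightarrow> bool) \<Rightarrow> 'a list \<Rightarrow> nat set \<Rightarrow> nat set \<Rightarrow> nat \<Rightarrow> 'a set" where
  "candidates V E xs S S' p = {u\<in>V. (\<forall>i\<in>S. E (xs ! i) u) \<and>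
      (\<forall>i\<in>S'. i < p \<longrightarrow> u \<noteq> xs ! i \<and> \<not> E (xs ! i) u)}"

lemma avoid_subset: "avoid E B v \<subseteq> B"
  by (auto simp: avoid_def)

lemma finite_indep_lists: "finite A \<Longrightarrow> finite (indep_lists E A k)"
  by (rule finite_subset[OF _ finite_lists_length_eq[of A k]]) (auto simp: indep_lists_def)

lemma card_indep_lists_le: "finite A \<Longrightarrow> card (indep_lists E A k) \<le> card A ^ k"
  using card_mono[OF finite_lists_length_eq[of A k], of "indep_lists E A k"]
  by (auto simp: indep_lists_def card_lists_length_eq)

section \<open>High degrees and dependent random choice\<close>

text \<open>Greedy choice: each selected vertex removes at most itself and its \<open>d\<close>
  neighbours from \<open>L\<close>. In \<open>induced_copy\<close> this shows that most vertices
  have large degree.\<close>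

lemma low_degree_independent:
  assumes "simple_graph V E" "L \<subseteq> V" "\<forall>v\<in>L. card {u\<in>V. E v u} \<le> d"
  shows "\<exists>I\<subseteq>L. independent_set V E I \<and> card L \<le> card I * (d + 1)"
  using assms(2,3)
proof (induction "card L" arbitrary: L rule: less_induct)
  case less
  have finV: "finite V" and irr: "\<And>x. x \<in> V \<Longrightarrow> \<not> E x x"
    and sym: "\<And>x y. x \<in> V \<Longrightarrow> y \<in> V \<Longrightarrow> E x y \<Longrightarrow> E y x"
    using assms(1) by (auto simp: simple_graph_def)
  have finL: "finite L" using less.prems(1) finV finite_subset by blast
  show ?case
  proof (cases "L = {}")
    case True
    then show ?thesis by (intro exI[of _ "{}"]) (auto simp: independent_set_def)
  next
    case False
    then obtain v where v: "v \<in> L" by blast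
    define L' where "L' = avoid E L v"
    have "card L' < card L"
      using v finL by (intro psubset_card_mono) (auto simp: L'_def avoid_def)
    moreover have "L' \<subseteq> V" "\<forall>v\<in>L'. card {u\<in>V. E v u} \<le> d"
      using less.prems by (auto simp: L'_def avoid_def)
    ultimately obtain I where I: "I \<subseteq> L'" "independent_set V E I" "card L' \<le> card I * (d + 1)"
      using less.hyps by blast
    have "L \<subseteq> L' \<union> insert v {u\<in>V. E v u}"
      using less.prems(1) by (auto simp: L'_def avoid_def)
    then have "card L \<le> card (L' \<union> insert v {u\<in>V. E v u})"
      using finL finV by (intro card_mono) (auto simp: L'_def avoid_def)
    also have "\<dots> \<le> card L' + card (insert v {u\<in>V. E v u})" by (rule card_Un_le)
    also have "card (insert v {u\<in>V. E v u}) \<le> d + 1"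
      using less.prems(2) v by (intro order_trans[OF card_insert_le_m1]) auto
    finally have cL: "card L \<le> card L' + (d + 1)" by simp
    have vI: "v \<notin> I" "finite I"
      using I(1) finL by (auto simp: L'_def avoid_def intro: finite_subset)
    have nv: "\<not> E v y" "\<not> E y v" if "y \<in> I" for y
      using that I(1) less.prems(1) v sym[of y v] by (auto simp: L'_def avoid_def)
    have "independent_set V E (insert v I)"
      using I(1,2) v nv less.prems(1) irr by (auto simp: independent_set_def L'_def avoid_def)
    moreover have "insert v I \<subseteq> L"
      using I(1) v by (auto simp: L'_def avoid_def)
    moreover have "card L \<le> card (insert v I) * (d + 1)"
      using cL I(3) vI by simp
    ultimately show ?thesis by blast
  qed
qed

text \<open>Random choice as double counting: a list \<open>ws\<close> of \<open>k\<close> vertices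
  is drawn uniformly and \<open>U\<close> is to be its common neighbourhood. A vertex of
  \<open>L\<close> lies in that neighbourhood for at least \<open>d ^ k\<close> lists, while an
  \<open>h\<close>-list with fewer than \<open>M\<close> common neighbours lies in it for at most
  \<open>M ^ k\<close>. By \<open>large\<close>, some neighbourhood has size at least
  \<open>u\<close> and contains no such \<open>h\<close>-list.\<close>

lemma dependent_random_choice:
  fixes V :: "'a set" and M u d k h :: nat
  assumes graph: "simple_graph V E"
    and L: "L \<subseteq> V" "\<forall>v\<in>L. d \<le> card {w\<in>V. E v w}"
    and large: "u * card V ^ k + card V ^ (h + 1) * M ^ k < card L * d ^ k"
  shows "\<exists>U\<subseteq>V. u \<le> card U \<and>
      (\<forall>ys. length ys = h \<longrightarrow> set ys \<subseteq> U \<longrightarrow> M \<le> card (common_nbrs V E (set ys)))"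
proof (rule ccontr)
  assume neg: "\<not> ?thesis"
  have finV: "finite V" and sym: "\<And>x y. x \<in> V \<Longrightarrow> y \<in> V \<Longrightarrow> E x y \<Longrightarrow> E y x"
    using graph by (auto simp: simple_graph_def)
  define W where "W = {ws. set ws \<subseteq> V \<and> length ws = k}"
  define Y where "Y = {ys. set ys \<subseteq> V \<and> length ys = h}"
  define Bad where "Bad = {ys\<in>Y. card (common_nbrs V E (set ys)) < M}"
  define A where "A ws = common_nbrs V E (set ws)" for ws
  define B where "B ws = {ys\<in>Bad. set ys \<subseteq> A ws}" for ws
  have finW: "finite W" and finY: "finite Y"
    and cW: "card W = card V ^ k" and cY: "card Y = card V ^ h"
    using finV by (simp_all add: W_def Y_def finite_lists_length_eq card_lists_length_eq)
  have finBad: "finite Bad" using finY by (simp add: Bad_def)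
  have finC: "finite (common_nbrs V E S)" for S
    using finV by (simp add: common_nbrs_def)
  \<comment> \<open>Without a bad list inside, \<open>A ws\<close> could serve as \<open>U\<close>,
    so \<open>neg\<close> forces its size below \<open>u\<close>. With a bad list inside, the
    trivial bound \<open>card V\<close> is enough.\<close>
  have cA: "card (A ws) \<le> u + card V * card (B ws)" for ws
  proof (cases "B ws = {}")
    case True
    have "A ws \<subseteq> V" by (auto simp: A_def common_nbrs_def)
    moreover have "M \<le> card (common_nbrs V E (set ys))"
      if "length ys = h" "set ys \<subseteq> A ws" for ys
    proof (rule ccontr)
      assume "\<not> ?thesis"
      then have "ys \<in> B ws" using that \<open>A ws \<subseteq> V\<close> by (auto simp: B_def Bad_def Y_def)
      then show False using True by simp
    qed
    ultimately have "\<not> u \<le> card (A ws)" using neg by blast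
    then show ?thesis by simp
  next
    case False
    have "finite (B ws)" using finBad by (simp add: B_def)
    then have "1 \<le> card (B ws)" using False by (simp add: Suc_le_eq card_gt_0_iff)
    moreover have "card (A ws) \<le> card V"
      using finV by (intro card_mono) (auto simp: A_def common_nbrs_def)
    moreover have "card V * 1 \<le> card V * card (B ws)"
      using \<open>1 \<le> card (B ws)\<close> by (rule mult_le_mono2)
    ultimately show ?thesis by linarith
  qed
  have cnt: "card {ws\<in>W. set ws \<subseteq> S} = card S ^ k" if "S \<subseteq> V" for S
  proof -
    have "{ws\<in>W. set ws \<subseteq> S} = {ws. set ws \<subseteq> S \<and> length ws = k}"
      using that by (auto simp: W_def)
    then show ?thesis using that finV by (simp add: card_lists_length_eq finite_subset)
  qed
  have "card L * d ^ k \<le> (\<Sum>v\<in>L. card {ws\<in>W. v \<in> A ws})"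
  proof -
    have "d ^ k \<le> card {ws\<in>W. v \<in> A ws}" if v: "v \<in> L" for v
    proof -
      have "{ws\<in>W. v \<in> A ws} = {ws\<in>W. set ws \<subseteq> {w\<in>V. E v w}}"
        using v L(1) sym by (fastforce simp: W_def A_def common_nbrs_def)
      then have "card {ws\<in>W. v \<in> A ws} = card {w\<in>V. E v w} ^ k" using cnt by simp
      then show ?thesis using L(2) v by (simp add: power_mono)
    qed
    then show ?thesis using sum_bounded_below[of L "d ^ k"] by simp
  qed
  also have "\<dots> = (\<Sum>ws\<in>W. card {v\<in>L. v \<in> A ws})"
    using sum_multicount_gen[of L W "\<lambda>v ws. v \<in> A ws" "\<lambda>ws. card {v\<in>L. v \<in> A ws}"]
      finW finV L(1) finite_subset by fastforce
  also have "\<dots> \<le> (\<Sum>ws\<in>W. u + card V * card (B ws))"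
  proof (rule sum_mono)
    fix ws
    have "card {v\<in>L. v \<in> A ws} \<le> card (A ws)"
      using finC by (intro card_mono) (auto simp: A_def)
    then show "card {v\<in>L. v \<in> A ws} \<le> u + card V * card (B ws)" using cA[of ws] by simp
  qed
  also have "\<dots> = u * card V ^ k + card V * (\<Sum>ws\<in>W. card (B ws))"
    by (simp add: sum.distrib cW sum_distrib_left)
  also have "(\<Sum>ws\<in>W. card (B ws)) = (\<Sum>ys\<in>Bad. card {ws\<in>W. set ys \<subseteq> A ws})"
    using sum_multicount_gen[of W Bad "\<lambda>ws ys. set ys \<subseteq> A ws" "\<lambda>ys. card {ws\<in>W. set ys \<subseteq> A ws}"]
      finW finBad by (simp add: B_def)
  also have "\<dots> \<le> card Bad * M ^ k"
  proof -
    have "card {ws\<in>W. set ys \<subseteq> A ws} \<le> M ^ k" if ys: "ys \<in> Bad" for ys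
    proof -
      have "{ws\<in>W. set ys \<subseteq> A ws} = {ws\<in>W. set ws \<subseteq> common_nbrs V E (set ys)}"
        using ys sym unfolding Bad_def Y_def W_def A_def common_nbrs_def by blast
      then have "card {ws\<in>W. set ys \<subseteq> A ws} = card (common_nbrs V E (set ys)) ^ k"
        using cnt[of "common_nbrs V E (set ys)"] by (auto simp: common_nbrs_def)
      then show ?thesis using ys by (simp add: Bad_def power_mono)
    qed
    then show ?thesis using sum_bounded_above[of Bad _ "M ^ k"] by simp
  qed
  also have "\<dots> \<le> card V ^ h * M ^ k"
    using card_mono[OF finY, of Bad] cY by (auto simp: Bad_def)
  finally have "card L * d ^ k \<le> u * card V ^ k + card V * (card V ^ h * M ^ k)" by simp
  then show False using large by simp
qed

section \<open>Nearly dominating vertices and many independent tuples in graphs without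
  \<open>K\<^sub>t\<^sub>t\<close>\<close>

locale Kmm_free_graph =
  fixes V :: "'a set" and E :: "'a \<Rightarrow> 'a \<Rightarrow> bool" and t :: nat
  assumes graph: "simple_graph V E"
    and t_pos: "0 < t"
    and Kmm_free: "\<not> contains_Kmm V E t"
begin

lemma finite_V: "finite V"
  and irrefl: "x \<in> V \<Longrightarrow> \<not> E x x"
  and symm: "x \<in> V \<Longrightarrow> y \<in> V \<Longrightarrow> E x y \<Longrightarrow> E y x"
  using graph by (auto simp: simple_graph_def)

lemma finite_sub: "A \<subseteq> V \<Longrightarrow> finite A"
  using finite_V finite_subset by blast

definition nearly_dominating :: "'a set \<Rightarrow> 'a set" where
  "nearly_dominating B = {v\<in>V. 4 * t * card (avoid E B v) < card B}"

lemma finite_nearly_dominating: "finite (nearly_dominating B)"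
  using finite_V by (simp add: nearly_dominating_def)

text \<open>Together, \<open>t\<close> such vertices miss at most a quarter of \<open>B\<close>, and
  they occupy at most another quarter. The remaining half has at least \<open>t\<close> vertices,
  all adjacent to all of them, which gives a \<open>K\<^sub>t\<^sub>t\<close>.\<close>

lemma card_nearly_dominating:
  assumes B: "B \<subseteq> V" "4 * t \<le> card B"
  shows "card (nearly_dominating B) < t"
proof (rule ccontr)
  assume "\<not> ?thesis"
  then obtain T where T: "T \<subseteq> nearly_dominating B" "card T = t" "finite T"
    using obtain_subset_with_card_n[of t "nearly_dominating B"] by (auto simp: not_less)
  define Q where "Q = (\<Union>v\<in>T. avoid E B v)"
  have finB: "finite B" using B finite_sub by blast
  have "4 * t * card Q \<le> 4 * t * (\<Sum>v\<in>T. card (avoid E B v))"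
    unfolding Q_def using card_UN_le[OF T(3)] by (intro mult_le_mono) auto
  also have "\<dots> = (\<Sum>v\<in>T. 4 * t * card (avoid E B v))" by (simp add: sum_distrib_left)
  also have "\<dots> \<le> (\<Sum>v\<in>T. card B)"
    using T(1) by (intro sum_mono) (auto simp: nearly_dominating_def)
  finally have "4 * t * card Q \<le> t * card B" using T(2) by simp
  then have "4 * card Q \<le> card B" using t_pos by simp
  moreover have "card B \<le> card (B - Q - T) + card Q + card T"
  proof -
    have "card B \<le> card ((B - Q - T) \<union> Q \<union> T)"
      using finB T(3) by (intro card_mono) (auto simp: Q_def avoid_def)
    also have "\<dots> \<le> card ((B - Q - T) \<union> Q) + card T" by (rule card_Un_le)
    also have "\<dots> \<le> card (B - Q - T) + card Q + card T" by (simp add: card_Un_le)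
    finally show ?thesis .
  qed
  ultimately have "t \<le> card (B - Q - T)" using B(2) T(2) by simp
  then obtain C where C: "C \<subseteq> B - Q - T" "card C = t"
    using obtain_subset_with_card_n by metis
  have "\<forall>a\<in>T. \<forall>b\<in>C. E a b"
    using C(1) by (auto simp: Q_def avoid_def)
  then have "contains_Kmm V E t"
    unfolding contains_Kmm_def using T C B(1)
    by (intro exI[of _ T] exI[of _ C]) (auto simp: nearly_dominating_def)
  then show False using Kmm_free by simp
qed

lemma card_avoid:
  assumes "v \<in> V" "v \<notin> nearly_dominating B"
  shows "card B \<le> 4 * t * card (avoid E B v)"
  using assms by (auto simp: nearly_dominating_def)

text \<open>The first entry \<open>v\<close> is taken outside \<open>nearly_dominating A\<close>,
  and the others recursively from \<open>avoid E A v\<close>, which is smaller than \<open>A\<close>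
  by at most a factor \<open>4 * t\<close>. The size hypothesis loses the same factor, so it
  survives the recursion.\<close>

lemma card_indep_lists_ge:
  assumes "A \<subseteq> V" "(4 * t) ^ (k + 1) \<le> card A"
  shows "card A ^ k \<le> (4 * t) ^ (k * k) * card (indep_lists E A k)"
  using assms
proof (induction k arbitrary: A)
  case 0
  have "indep_lists E A 0 = {[]}" by (auto simp: indep_lists_def)
  then show ?case by simp
next
  case (Suc k)
  define G where "G = A - nearly_dominating A"
  have finA: "finite A" using Suc.prems(1) finite_sub by blast
  have "4 * t * 1 \<le> 4 * t * (4 * t) ^ (k + 1)"
    using t_pos by (intro mult_le_mono2) simp
  then have "4 * t \<le> (4 * t) ^ (Suc k + 1)" by simp
  then have A4: "4 * t \<le> card A" using Suc.prems(2) by linarith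
  have "card (nearly_dominating A) < t" using card_nearly_dominating Suc.prems(1) A4 by blast
  moreover have "card A \<le> card G + card (nearly_dominating A)"
    unfolding G_def using diff_card_le_card_Diff[OF finite_nearly_dominating, of A A] by linarith
  ultimately have cG: "card A \<le> 4 * t * card G"
  proof -
    assume a: "card (nearly_dominating A) < t" "card A \<le> card G + card (nearly_dominating A)"
    have "card A \<le> 4 * card G" using a A4 by linarith
    also have "\<dots> \<le> 4 * t * card G" using t_pos by simp
    finally show ?thesis .
  qed
  define P where "P v = (\<lambda>xs. v # xs) ` indep_lists E (avoid E A v) k" for v
  have sub: "(\<Union>v\<in>G. P v) \<subseteq> indep_lists E A (Suc k)"
  proof -
    have "v # xs \<in> indep_lists E A (Suc k)"
      if v: "v \<in> G" and xs: "xs \<in> indep_lists E (avoid E A v) k" for v xs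
    proof -
      have 1: "x \<in> A \<and> x \<noteq> v \<and> \<not> E v x" if "x \<in> set xs" for x
        using that xs by (auto simp: indep_lists_def avoid_def)
      moreover have "\<not> E x v" if "x \<in> set xs" for x
        using 1[OF that] symm[of x v] v Suc.prems(1) by (auto simp: G_def)
      ultimately show ?thesis
        using xs v irrefl Suc.prems(1) by (auto simp: indep_lists_def G_def)
    qed
    then show ?thesis by (auto simp: P_def)
  qed
  have each: "card A ^ k \<le> (4 * t) ^ (k * k + k) * card (P v)" if v: "v \<in> G" for v
  proof -
    have c: "card A \<le> 4 * t * card (avoid E A v)"
      using v Suc.prems(1) by (intro card_avoid) (auto simp: G_def)
    moreover have "4 * t * (4 * t) ^ (k + 1) \<le> card A" using Suc.prems(2) by simp
    ultimately have "4 * t * (4 * t) ^ (k + 1) \<le> 4 * t * card (avoid E A v)" by linarith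
    then have "(4 * t) ^ (k + 1) \<le> card (avoid E A v)"
      using t_pos by (simp only: mult_le_cancel1)
    then have IH: "card (avoid E A v) ^ k \<le> (4 * t) ^ (k * k) * card (indep_lists E (avoid E A v) k)"
      using Suc.IH[of "avoid E A v"] Suc.prems(1) avoid_subset[of E A v] by blast
    have "card A ^ k \<le> (4 * t * card (avoid E A v)) ^ k" using c by (simp add: power_mono)
    also have "\<dots> = (4 * t) ^ k * card (avoid E A v) ^ k" by (simp add: power_mult_distrib)
    also have "\<dots> \<le> (4 * t) ^ k * ((4 * t) ^ (k * k) * card (indep_lists E (avoid E A v) k))"
      using IH by (rule mult_le_mono2)
    also have "card (indep_lists E (avoid E A v) k) = card (P v)"
      unfolding P_def by (simp add: card_image inj_on_def)
    finally show ?thesis by (simp add: power_add mult_ac)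
  qed
  have finP: "finite (P v)" for v
    unfolding P_def using finA avoid_subset[of E A v]
    by (intro finite_imageI finite_indep_lists) (auto intro: finite_subset)
  have finG: "finite G" using finA by (simp add: G_def)
  have "card A ^ Suc k \<le> (4 * t * card G) * card A ^ k" using cG by simp
  also have "\<dots> = 4 * t * (\<Sum>v\<in>G. card A ^ k)" by simp
  also have "\<dots> \<le> 4 * t * (\<Sum>v\<in>G. (4 * t) ^ (k * k + k) * card (P v))"
    using each by (intro mult_le_mono2 sum_mono) auto
  also have "\<dots> = (4 * t) ^ (k * k + k + 1) * (\<Sum>v\<in>G. card (P v))"
    by (simp only: sum_distrib_left[symmetric]) (simp add: mult_ac)
  also have "(\<Sum>v\<in>G. card (P v)) = card (\<Union>v\<in>G. P v)"
    using finG finP by (intro card_UN_disjoint[symmetric]) (auto simp: P_def)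
  also have "\<dots> \<le> card (indep_lists E A (Suc k))"
    using sub finite_indep_lists[OF finA] by (rule card_mono[rotated])
  \<comment> \<open>The exponent collects \<open>k * k\<close> from the induction, \<open>k\<close>
    from replacing \<open>A\<close> by \<open>avoid E A v\<close> in a \<open>k\<close>-th power,
    and 1 from the choice of \<open>v\<close> in \<open>G\<close>.\<close>
  also have "(4 * t) ^ (k * k + k + 1) \<le> (4 * t) ^ (Suc k * Suc k)"
    using t_pos by (intro power_increasing) auto
  finally show ?case by simp
qed

section \<open>Spoiled tuples and the shrinking of candidate sets\<close>

lemma candidates_subset: "candidates V E xs S S' p \<subseteq> V"
  by (auto simp: candidates_def)

text \<open>The size condition is the one under which \<open>card_nearly_dominating\<close> leaves
  fewer than \<open>t\<close> spoiling entries.\<close>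

definition spoiled :: "nat set \<Rightarrow> nat set \<Rightarrow> nat \<Rightarrow> 'a list \<Rightarrow> bool" where
  "spoiled S S' p xs \<longleftrightarrow> 4 * t \<le> card (candidates V E xs S S' p) \<and>
      xs ! p \<in> nearly_dominating (candidates V E xs S S' p)"

text \<open>
  The candidate set at step \<open>p\<close> does not depend on the entry \<open>xs ! p\<close>, so deleting that entry
  maps spoiled lists to independent ones with fibres of size at most \<open>t\<close>.
\<close>

lemma card_spoiled:
  assumes U: "U \<subseteq> V" and p: "p \<le> k" "p \<notin> S"
  shows "card {xs\<in>indep_lists E U (Suc k). spoiled S S' p xs} \<le> t * card (indep_lists E U k)"
proof -
  define del where "del xs = take p xs @ drop (Suc p) xs" for xs :: "'a list"
  define Z where "Z = {xs\<in>indep_lists E U (Suc k). spoiled S S' p xs}"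
  have finU: "finite U" using U finite_sub by blast
  have del: "del xs \<in> indep_lists E U k" if "xs \<in> Z" for xs
  proof -
    have "length (del xs) = k" using that p by (auto simp: Z_def indep_lists_def del_def)
    moreover have s: "set (del xs) \<subseteq> set xs"
      using set_take_subset[of p xs] set_drop_subset[of "Suc p" xs] by (auto simp: del_def)
    moreover have "distinct (del xs)"
    proof -
      have "distinct xs" using that by (auto simp: Z_def indep_lists_def)
      then show ?thesis
        using set_take_disj_set_drop_if_distinct[of xs p "Suc p"] by (simp add: del_def)
    qed
    ultimately show ?thesis using that unfolding Z_def indep_lists_def by blast
  qed
  have fibre: "card {xs\<in>Z. del xs = ys} \<le> t" for ys
  proof (cases "{xs\<in>Z. del xs = ys} = {}")
    case False
    then obtain x0 where x0: "x0 \<in> Z" "del x0 = ys" by auto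
    define C where "C = candidates V E x0 S S' p"
    \<comment> \<open>All lists of one fibre differ from \<open>x0\<close> only at \<open>p\<close>,
      so they share the candidate set \<open>C\<close>. Each is then determined by its entry at
      \<open>p\<close>, a nearly dominating vertex of \<open>C\<close>.\<close>
    have "xs \<in> (\<lambda>v. x0[p := v]) ` nearly_dominating C" if xs: "xs \<in> Z" "del xs = ys" for xs
    proof -
      have len: "length xs = Suc k" "length x0 = Suc k"
        using xs x0 by (auto simp: Z_def indep_lists_def)
      have "take p xs = take p x0 \<and> drop (Suc p) xs = drop (Suc p) x0"
        using xs(2) x0(2) len p by (auto simp: del_def)
      then have eq: "xs = x0[p := xs ! p]"
        using id_take_nth_drop[of p xs] upd_conv_take_nth_drop[of p x0 "xs ! p"] len p by simp
      have off: "xs ! i = x0 ! i" if "i \<noteq> p" for i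
        using eq that by (metis nth_list_update_neq)
      have "\<forall>i\<in>S. xs ! i = x0 ! i"
      proof
        fix i assume "i \<in> S"
        then show "xs ! i = x0 ! i" using p(2) by (intro off) auto
      qed
      moreover have "\<forall>i<p. xs ! i = x0 ! i" using off by simp
      ultimately have "candidates V E xs S S' p = C"
        unfolding C_def candidates_def by auto
      then show ?thesis using xs(1) eq by (auto simp: Z_def spoiled_def)
    qed
    then have "{xs\<in>Z. del xs = ys} \<subseteq> (\<lambda>v. x0[p := v]) ` nearly_dominating C" by blast
    then have "card {xs\<in>Z. del xs = ys} \<le> card (nearly_dominating C)"
      using finite_nearly_dominating surj_card_le by blast
    also have "\<dots> < t"
      using x0(1) candidates_subset by (intro card_nearly_dominating) (auto simp: Z_def spoiled_def C_def)
    finally show ?thesis by simp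
  next
    case True
    show ?thesis unfolding True by simp
  qed
  have "Z = (\<Union>ys\<in>indep_lists E U k. {xs\<in>Z. del xs = ys})" using del by blast
  then have "card Z \<le> (\<Sum>ys\<in>indep_lists E U k. card {xs\<in>Z. del xs = ys})"
    using card_UN_le[OF finite_indep_lists[OF finU]] by metis
  also have "\<dots> \<le> (\<Sum>ys\<in>indep_lists E U k. t)" using fibre by (intro sum_mono)
  finally show ?thesis by (simp add: Z_def mult.commute)
qed

text \<open>A step with \<open>p\<close> in \<open>S'\<close> replaces the set by its
  \<open>avoid\<close> set at \<open>xs ! p\<close> and costs a factor of at most
  \<open>4 * t\<close>; other steps change nothing. By \<open>M\<close>, at least
  \<open>4 * t\<close> candidates remain before each step below \<open>h\<close>, so a step that is
  not spoiled really has an entry that is not nearly dominating.\<close>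

lemma card_candidates:
  assumes xs: "set xs \<subseteq> V" "h \<le> length xs"
    and M: "(4 * t) ^ (h + 1) \<le> card (candidates V E xs S S' 0)"
    and ns: "\<And>p. p \<in> S' \<Longrightarrow> p < h \<Longrightarrow> \<not> spoiled S S' p xs"
    and p: "p \<le> h"
  shows "card (candidates V E xs S S' 0) \<le> (4 * t) ^ p * card (candidates V E xs S S' p)"
  using p
proof (induction p)
  case (Suc p)
  let ?c = "\<lambda>p. card (candidates V E xs S S' p)"
  have IH: "?c 0 \<le> (4 * t) ^ p * ?c p" using Suc by simp
  have "?c p \<le> 4 * t * ?c (Suc p)"
  proof (cases "p \<in> S'")
    case True
    have "(4 * t) ^ p * (4 * t) \<le> (4 * t) ^ (h + 1)"
      using power_increasing[of "p + 1" "h + 1" "4 * t"] Suc.prems t_pos by (simp add: mult_ac)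
    also have "\<dots> \<le> (4 * t) ^ p * ?c p" using M IH by linarith
    finally have "4 * t \<le> ?c p" using t_pos by simp
    then have "xs ! p \<notin> nearly_dominating (candidates V E xs S S' p)"
      using ns[OF True] Suc.prems by (simp add: spoiled_def)
    moreover have "xs ! p \<in> V" using xs Suc.prems by (meson nth_mem Suc_le_lessD less_le_trans subsetD)
    ultimately have "?c p \<le> 4 * t * card (avoid E (candidates V E xs S S' p) (xs ! p))"
      using card_avoid by blast
    also have "avoid E (candidates V E xs S S' p) (xs ! p) = candidates V E xs S S' (Suc p)"
      using True by (auto simp: avoid_def candidates_def less_Suc_eq)
    finally show ?thesis .
  next
    case False
    then have "candidates V E xs S S' (Suc p) = candidates V E xs S S' p"
      unfolding candidates_def by (metis less_Suc_eq)
    then show ?thesis using t_pos by simp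
  qed
  then have "(4 * t) ^ p * ?c p \<le> (4 * t) ^ p * (4 * t * ?c (Suc p))" by (rule mult_le_mono2)
  then have "?c 0 \<le> (4 * t) ^ p * (4 * t * ?c (Suc p))" using IH by linarith
  then show ?case by (simp add: mult_ac)
qed simp

section \<open>Embedding a bipartite graph\<close>

text \<open>Greedy choice: the vertex for \<open>j0\<close> is taken outside the nearly dominating
  sets of all other \<open>D j\<close>, fewer vertices than \<open>D j0\<close> has. Each
  \<open>D j\<close> is then cut down to the non-neighbours of that vertex, at the price of one
  factor \<open>4 * t\<close>.\<close>

lemma independent_transversal:
  assumes "finite J" "\<forall>j\<in>J. D j \<subseteq> V \<and> (4 * t) ^ (card J + 1) \<le> card (D j)"
  shows "\<exists>y. (\<forall>j\<in>J. y j \<in> D j) \<and> (\<forall>i\<in>J. \<forall>j\<in>J. i \<noteq> j \<longrightarrow> y i \<noteq> y j \<and> \<not> E (y i) (y j))"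
  using assms
proof (induction J arbitrary: D rule: finite_induct)
  case (insert j0 J)
  let ?m = "card J"
  have cJ: "card (insert j0 J) = Suc ?m" using insert by simp
  have big: "4 * t \<le> (4 * t) ^ (Suc ?m + 1)"
    using power_increasing[of 1 "Suc ?m + 1" "4 * t"] t_pos by simp
  define Z where "Z = (\<Union>j\<in>J. nearly_dominating (D j))"
  have "card Z \<le> (\<Sum>j\<in>J. card (nearly_dominating (D j)))"
    unfolding Z_def by (rule card_UN_le[OF insert(1)])
  also have "\<dots> \<le> (\<Sum>j\<in>J. t)"
  proof (rule sum_mono)
    fix j assume "j \<in> J"
    then have "D j \<subseteq> V" "(4 * t) ^ (Suc ?m + 1) \<le> card (D j)" using insert.prems cJ by auto
    then have "D j \<subseteq> V" "4 * t \<le> card (D j)" using big by linarith+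
    then show "card (nearly_dominating (D j)) \<le> t" using card_nearly_dominating[of "D j"] by simp
  qed
  also have "\<dots> = ?m * t" by simp
  also have "\<dots> < (4 * t) ^ (Suc ?m + 1)"
  proof -
    have "?m < 2 ^ ?m" by simp
    also have "\<dots> \<le> (4 * t) ^ ?m" using t_pos by (intro power_mono) auto
    finally have "?m * t < (4 * t) ^ ?m * t" using t_pos by simp
    also have "\<dots> \<le> (4 * t) ^ ?m * ((4 * t) * (4 * t))"
      by (intro mult_le_mono2) (simp add: trans_le_add1 le_square[of "4 * t", THEN order_trans[rotated]])
    finally show ?thesis by (simp add: mult_ac)
  qed
  also have "\<dots> \<le> card (D j0)" using insert.prems cJ by simp
  finally have "card Z < card (D j0)" .
  then have "\<not> D j0 \<subseteq> Z"
    using card_mono[of Z "D j0"] insert(1) finite_nearly_dominating by (fastforce simp: Z_def)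
  then obtain v where v: "v \<in> D j0" "v \<notin> Z" by blast
  have vV: "v \<in> V" using v insert.prems by auto
  define D' where "D' j = avoid E (D j) v" for j
  have "D' j \<subseteq> V \<and> (4 * t) ^ (?m + 1) \<le> card (D' j)" if j: "j \<in> J" for j
  proof -
    have "4 * t * (4 * t) ^ (?m + 1) \<le> card (D j)" using insert.prems cJ j by simp
    also have "\<dots> \<le> 4 * t * card (D' j)"
      unfolding D'_def using v(2) vV j by (intro card_avoid) (auto simp: Z_def)
    finally have "(4 * t) ^ (?m + 1) \<le> card (D' j)" using t_pos by (simp only: mult_le_cancel1)
    then show ?thesis using insert.prems j avoid_subset[of E "D j" v] by (auto simp: D'_def)
  qed
  then obtain y where y: "\<forall>j\<in>J. y j \<in> D' j"
    "\<forall>i\<in>J. \<forall>j\<in>J. i \<noteq> j \<longrightarrow> y i \<noteq> y j \<and> \<not> E (y i) (y j)"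
    using insert.IH[of D'] by blast
  have y': "y j \<in> D j \<and> y j \<noteq> v \<and> \<not> E v (y j) \<and> \<not> E (y j) v" if "j \<in> J" for j
  proof -
    have "y j \<in> D j" "y j \<noteq> v" "\<not> E v (y j)" using y(1) that by (auto simp: D'_def avoid_def)
    moreover have "y j \<in> V" using \<open>y j \<in> D j\<close> insert.prems that by auto
    ultimately show ?thesis using symm vV by blast
  qed
  show ?case
    using insert(2) v(1) y' y(2) by (intro exI[of _ "y(j0 := v)"]) auto
qed simp

text \<open>Otherwise the count grows by at most a factor \<open>r\<close> at every length from
  \<open>h\<close> on, so there are at most \<open>r ^ h * card U ^ h\<close> tuples of length
  \<open>2 * h\<close>. This contradicts \<open>card_indep_lists_ge\<close>: its loss
  \<open>(4 * t) ^ (4 * h * h)\<close> is an \<open>h\<close>-th power, so taking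
  \<open>h\<close>-th roots leaves only \<open>(4 * t) ^ (4 * h)\<close>.\<close>

lemma long_indep_lists:
  assumes U: "U \<subseteq> V" "(4 * t) ^ (2 * h + 1) \<le> card U" "r * (4 * t) ^ (4 * h) < card U" and h: "0 < h"
  shows "\<exists>k\<ge>h. r * card (indep_lists E U k) < card (indep_lists E U (Suc k))"
proof (rule ccontr)
  assume "\<not> ?thesis"
  then have step: "card (indep_lists E U (Suc k)) \<le> r * card (indep_lists E U k)" if "h \<le> k" for k
    using that by (auto simp: not_less)
  have it: "card (indep_lists E U (h + i)) \<le> r ^ i * card U ^ h" for i
  proof (induction i)
    case 0
    then show ?case using card_indep_lists_le[OF finite_sub[OF U(1)]] by simp
  next
    case (Suc i)
    have "card (indep_lists E U (h + Suc i)) \<le> r * card (indep_lists E U (h + i))"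
      using step[of "h + i"] by simp
    also have "\<dots> \<le> r * (r ^ i * card U ^ h)" using Suc by (rule mult_le_mono2)
    finally show ?case by simp
  qed
  have "card U ^ h * card U ^ h = card U ^ (2 * h)" by (simp add: power_add mult_2)
  also have "\<dots> \<le> (4 * t) ^ (2 * h * (2 * h)) * card (indep_lists E U (2 * h))"
    using card_indep_lists_ge U by blast
  also have "\<dots> \<le> (4 * t) ^ (2 * h * (2 * h)) * (r ^ h * card U ^ h)"
    using it[of h] by (intro mult_le_mono2) (simp add: mult_2)
  also have "\<dots> = (r * (4 * t) ^ (4 * h)) ^ h * card U ^ h"
    by (simp add: power_mult_distrib power_mult[symmetric] mult_ac)
  finally have "card U ^ h \<le> (r * (4 * t) ^ (4 * h)) ^ h" using U(3) by simp
  moreover have "(r * (4 * t) ^ (4 * h)) ^ h < card U ^ h"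
    using U(3) h by (intro power_strict_mono) auto
  ultimately show False by simp
qed

text \<open>The last bound on \<open>card U\<close> is that of \<open>long_indep_lists\<close> with
  \<open>r = h * h * t\<close>. The exponent \<open>2 * h + 1\<close> in \<open>nbrs\<close> is
  spent as \<open>h\<close> on excluding non-neighbours and \<open>h + 1\<close> on the
  transversal.\<close>

lemma bipartite_embedding:
  assumes F: "simple_graph {0..<h} F" "bipartite {0..<h} F" and h: "0 < h"
    and U: "U \<subseteq> V" "(4 * t) ^ (2 * h + 1) \<le> card U" "h * h * t * (4 * t) ^ (4 * h) < card U"
    and nbrs: "\<And>ys. length ys = h \<Longrightarrow> set ys \<subseteq> U \<Longrightarrow>
        (4 * t) ^ (2 * h + 1) \<le> card (common_nbrs V E (set ys))"
  shows "contains_induced {0..<h} F V E"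
proof -
  obtain X Y where XY: "X \<union> Y = {0..<h}" "X \<inter> Y = {}"
    "independent_set {0..<h} F X" "independent_set {0..<h} F Y"
    using F(2) by (auto simp: bipartite_def)
  have symF: "F i j \<Longrightarrow> F j i" if "i < h" "j < h" for i j
    using F(1) that by (auto simp: simple_graph_def)
  define S where "S j = {i\<in>X. F i j}" for j
  define S' where "S' j = {i\<in>X. \<not> F i j}" for j
  have finU: "finite U" using U(1) finite_sub by blast
  obtain k where k: "h \<le> k" "h * h * t * card (indep_lists E U k) < card (indep_lists E U (Suc k))"
    using long_indep_lists[OF U h] by blast
  define Z where "Z j p = {xs\<in>indep_lists E U (Suc k). spoiled (S j) (S' j) p xs}" for j p
  \<comment> \<open>\<open>I\<close> lists the at most \<open>h * h\<close> pairs of a vertex and a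
    step that can be spoiled. By \<open>card_spoiled\<close> and the choice of \<open>k\<close>,
    they do not exhaust the tuples of length \<open>Suc k\<close>.\<close>
  define I where "I = (SIGMA j:{0..<h}. {p. p < h \<and> p \<in> S' j})"
  have "I \<subseteq> {0..<h} \<times> {0..<h}" by (auto simp: I_def)
  then have "finite I" "card I \<le> h * h"
    using finite_subset card_mono[of "{0..<h} \<times> {0..<h}" I] by auto
  have "card (\<Union>(j, p)\<in>I. Z j p) \<le> (\<Sum>(j, p)\<in>I. card (Z j p))"
    using card_UN_le[OF \<open>finite I\<close>, of "\<lambda>(j, p). Z j p"] by (simp add: case_prod_beta)
  also have "\<dots> \<le> (\<Sum>(j, p)\<in>I. t * card (indep_lists E U k))"
    unfolding Z_def using U(1) k(1)
    by (intro sum_mono) (auto simp: I_def S_def S'_def intro!: card_spoiled)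
  also have "\<dots> = card I * (t * card (indep_lists E U k))" by (simp add: case_prod_beta)
  also have "\<dots> \<le> h * h * (t * card (indep_lists E U k))"
    using \<open>card I \<le> h * h\<close> by (rule mult_le_mono1)
  also have "\<dots> < card (indep_lists E U (Suc k))" using k(2) by (simp add: mult_ac)
  finally have "card (\<Union>(j, p)\<in>I. Z j p) < card (indep_lists E U (Suc k))" .
  moreover have "finite (\<Union>(j, p)\<in>I. Z j p)"
    using \<open>finite I\<close> finite_indep_lists[OF finU] by (auto simp: Z_def)
  ultimately have "\<not> indep_lists E U (Suc k) \<subseteq> (\<Union>(j, p)\<in>I. Z j p)"
    using card_mono leD by blast
  then obtain xs where xs: "xs \<in> indep_lists E U (Suc k)" and good: "\<forall>(j, p)\<in>I. xs \<notin> Z j p"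
    by auto
  have xs': "length xs = Suc k" "set xs \<subseteq> U" "distinct xs"
    "\<And>x y. x \<in> set xs \<Longrightarrow> y \<in> set xs \<Longrightarrow> \<not> E x y"
    using xs by (auto simp: indep_lists_def)
  have mem: "xs ! i \<in> set xs" if "i < h" for i using that xs'(1) k(1) by simp
  define D where "D j = candidates V E xs (S j) (S' j) h" for j
  have D: "D j \<subseteq> V \<and> (4 * t) ^ (card Y + 1) \<le> card (D j)" if j: "j \<in> Y" for j
  proof -
    have jh: "j < h" using j XY(1) by auto
    let ?c = "\<lambda>p. card (candidates V E xs (S j) (S' j) p)"
    \<comment> \<open>Only the first \<open>h\<close> entries matter: \<open>nbrs\<close> speaks of
      lists of length exactly \<open>h\<close>, and all indices in \<open>S j\<close> lie below
      \<open>h\<close>.\<close>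
    have "common_nbrs V E (set (take h xs)) \<subseteq> candidates V E xs (S j) (S' j) 0"
    proof -
      have "xs ! i \<in> set (take h xs)" if "i \<in> S j" for i
      proof -
        have "i < h" using that XY(1) by (auto simp: S_def)
        then show ?thesis using xs'(1) k(1) by (auto simp: in_set_conv_nth intro!: exI[of _ i])
      qed
      then show ?thesis by (auto simp: common_nbrs_def candidates_def)
    qed
    then have "card (common_nbrs V E (set (take h xs))) \<le> ?c 0"
      using finite_sub[OF candidates_subset] by (intro card_mono)
    moreover have "(4 * t) ^ (2 * h + 1) \<le> card (common_nbrs V E (set (take h xs)))"
      using xs' k(1) set_take_subset[of h xs] by (intro nbrs) auto
    ultimately have c0: "(4 * t) ^ (2 * h + 1) \<le> ?c 0" by linarith
    moreover have "(4 * t) ^ (h + 1) \<le> (4 * t) ^ (2 * h + 1)"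
      using t_pos by (intro power_increasing) auto
    ultimately have "(4 * t) ^ (h + 1) \<le> ?c 0" by linarith
    then have "?c 0 \<le> (4 * t) ^ h * ?c h"
      using xs' U(1) k(1) good xs jh
      by (intro card_candidates[where h = h]) (auto simp: I_def Z_def)
    then have "(4 * t) ^ (2 * h + 1) \<le> (4 * t) ^ h * ?c h" using c0 by linarith
    moreover have "(4 * t) ^ (2 * h + 1) = (4 * t) ^ h * (4 * t) ^ (h + 1)"
      unfolding power_add[symmetric] by (simp add: mult_2)
    ultimately have "(4 * t) ^ h * (4 * t) ^ (h + 1) \<le> (4 * t) ^ h * ?c h" by linarith
    then have "(4 * t) ^ (h + 1) \<le> ?c h" using t_pos by (simp only: mult_le_cancel1) simp
    moreover have "(4 * t) ^ (card Y + 1) \<le> (4 * t) ^ (h + 1)"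
      using card_mono[of "{0..<h}" Y] XY(1) t_pos by (intro power_increasing) auto
    ultimately have "(4 * t) ^ (card Y + 1) \<le> ?c h" by linarith
    then show ?thesis using candidates_subset unfolding D_def by blast
  qed
  have finY: "finite Y" using XY(1) finite_subset[of Y "{0..<h}"] by auto
  obtain y where y: "\<forall>j\<in>Y. y j \<in> D j"
    "\<forall>i\<in>Y. \<forall>j\<in>Y. i \<noteq> j \<longrightarrow> y i \<noteq> y j \<and> \<not> E (y i) (y j)"
    using independent_transversal[OF finY, of D] D by blast
  have yV: "y j \<in> V" if "j \<in> Y" for j using y(1) D that by blast
  have xV: "xs ! i \<in> V" if "i \<in> X" for i
  proof -
    have "i < h" using that XY(1) by auto
    then show ?thesis using mem xs'(2) U(1) by blast
  qed
  have mixed: "(E (xs ! i) (y j) \<longleftrightarrow> F i j) \<and> (E (y j) (xs ! i) \<longleftrightarrow> F j i) \<and> y j \<noteq> xs ! i"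
    if i: "i \<in> X" and j: "j \<in> Y" for i j
  proof -
    have ij: "i < h" "j < h" using i j XY(1) by auto
    have yD: "y j \<in> candidates V E xs (S j) (S' j) h" using y(1) j by (simp add: D_def)
    have 1: "E (xs ! i) (y j) \<longleftrightarrow> F i j"
      using yD i ij by (auto simp: candidates_def S_def S'_def)
    \<comment> \<open>For a non-neighbour the candidate set excludes equality; for a neighbour
      equality would be a loop.\<close>
    have 2: "y j \<noteq> xs ! i"
      using yD i ij irrefl[OF xV[OF i]] by (auto simp: candidates_def S_def S'_def)
    show ?thesis using 1 2 symF[of i j] symF[of j i] ij symm xV[OF i] yV[OF j] by blast
  qed
  define f where "f i = (if i \<in> X then xs ! i else y i)" for i
  have inX: "i < h \<Longrightarrow> i \<notin> X \<Longrightarrow> i \<in> Y" for i using XY(1) by auto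
  have "inj_on f {0..<h}"
  proof (rule inj_onI)
    fix i j assume ij: "i \<in> {0..<h}" "j \<in> {0..<h}" "f i = f j"
    have "i = j" if "i \<in> X" "j \<in> X"
      using ij that xs'(1,3) k(1) by (simp add: f_def nth_eq_iff_index_eq)
    moreover have "i = j" if "i \<notin> X" "j \<notin> X"
      using ij that y(2) inX by (auto simp: f_def)
    moreover have "f i' \<noteq> f j'" if "i' \<in> X" "j' \<notin> X" "j' < h" for i' j'
      using mixed[OF that(1) inX[OF that(3,2)]] that(1,2) by (auto simp: f_def)
    ultimately show "i = j"
      using ij by (metis atLeastLessThan_iff)
  qed
  moreover have "f ` {0..<h} \<subseteq> V"
  proof
    fix v assume "v \<in> f ` {0..<h}"
    then obtain i where "i < h" "v = f i" by auto
    then show "v \<in> V" using xV[of i] yV[OF inX[of i]] by (cases "i \<in> X") (simp_all add: f_def)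
  qed
  moreover have "E (f i) (f j) \<longleftrightarrow> F i j" if ij: "i < h" "j < h" for i j
  proof -
    have XX: "\<not> F i j" "\<not> E (xs ! i) (xs ! j)" if "i \<in> X" "j \<in> X"
      using XY(3) that xs'(4) mem ij by (auto simp: independent_set_def)
    have YY: "\<not> F i j" "\<not> E (y i) (y j)" if "i \<in> Y" "j \<in> Y"
    proof -
      show "\<not> F i j" using XY(4) that by (auto simp: independent_set_def)
      show "\<not> E (y i) (y j)" using y(2) that irrefl[OF yV] by (cases "i = j") auto
    qed
    show ?thesis
    proof (cases "i \<in> X"; cases "j \<in> X")
      assume "i \<in> X" "j \<in> X"
      then show ?thesis using XX by (simp add: f_def)
    next
      assume a: "i \<in> X" "j \<notin> X"
      then show ?thesis using mixed[OF a(1) inX[OF ij(2) a(2)]] by (simp add: f_def)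
    next
      assume a: "i \<notin> X" "j \<in> X"
      then show ?thesis using mixed[OF a(2) inX[OF ij(1) a(1)]] by (simp add: f_def)
    next
      assume a: "i \<notin> X" "j \<notin> X"
      then show ?thesis using YY[OF inX[OF ij(1) a(1)] inX[OF ij(2) a(2)]] by (simp add: f_def)
    qed
  qed
  ultimately show ?thesis by (auto simp: contains_induced_def)
qed

section \<open>Choice of parameters\<close>

text \<open>All thresholds are expressed as powers of the single number
  \<open>s = 8 * h * h * t\<close>, which absorbs both the factor \<open>4 * t\<close> of the
  shrinking steps and the factor \<open>h * h * t\<close> of the spoiled tuples.\<close>

lemma induced_copy:
  assumes F: "simple_graph {0..<h} F" "bipartite {0..<h} F" and h: "0 < h"
    and indep: "\<And>I. independent_set V E I \<Longrightarrow> card I < t"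
    and large: "(8 * h * h * t) ^ (16 * h) \<le> card V"
  shows "contains_induced {0..<h} F V E"
proof -
  define s where "s = 8 * h * h * t"
  define n where "n = card V"
  define e where "e = n div s"
  define L where "L = {v\<in>V. e + 1 \<le> card {u\<in>V. E v u}}"
  \<comment> \<open>With \<open>M = s ^ (4 * h)\<close>, the choice \<open>k = 2 * (h + 1)\<close>
    turns \<open>M ^ k\<close> into \<open>(s ^ (8 * h)) ^ (h + 1)\<close>, at most
    \<open>n ^ (h + 1)\<close>. The bad lists then contribute at most \<open>n ^ k\<close>.\<close>
  define k where "k = 2 * h + 2"
  have hht: "t \<le> h * h * t" using h by simp
  have s8: "8 * t \<le> s" "h * h * t < s"
    using hht h t_pos by (simp_all add: s_def)
  have s1: "8 \<le> s" using s8(1) t_pos by linarith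
  have mono: "s ^ a \<le> s ^ b" if "a \<le> b" for a b using that s1 by (intro power_increasing) auto
  have n: "s ^ (16 * h) \<le> n" using large by (simp add: s_def n_def)
  have sn: "s \<le> n" using mono[of 1 "16 * h"] h n by simp
  have "card (V - L) \<le> t * (e + 1)"
  proof -
    have "\<forall>v\<in>V - L. card {u\<in>V. E v u} \<le> e" by (auto simp: L_def)
    then obtain I where I: "I \<subseteq> V - L" "independent_set V E I" "card (V - L) \<le> card I * (e + 1)"
      using low_degree_independent[OF graph, of "V - L" e] by blast
    have "card I * (e + 1) \<le> t * (e + 1)" using indep[OF I(2)] by (intro mult_le_mono1) simp
    then show ?thesis using I(3) by linarith
  qed
  moreover have "4 * t * e \<le> n"
  proof -
    have "4 * t * e \<le> s * e" using s8(1) by (intro mult_le_mono1) simp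
    then show ?thesis unfolding e_def using times_div_less_eq_dividend[of s n] by linarith
  qed
  moreover have "t * (e + 1) = t * e + t" by simp
  \<comment> \<open>The bound \<open>t * e + t\<close> is at most
    \<open>n / 4 + n / 8\<close>.\<close>
  ultimately have "2 * card (V - L) \<le> n" using s8(1) sn by linarith
  moreover have "card (V - L) = n - card L"
    unfolding n_def using finite_V by (intro card_Diff_subset) (auto simp: L_def)
  ultimately have cL: "n \<le> 2 * card L" by linarith
  have sd: "n \<le> s * (e + 1)"
    unfolding e_def using s1 dividend_less_times_div[of s n] by (simp add: algebra_simps)
  have "s ^ (8 * h) * n ^ k + n ^ (h + 1) * (s ^ (4 * h)) ^ k < card L * (e + 1) ^ k"
  proof -
    have "(s ^ (4 * h)) ^ k = (s ^ (8 * h)) ^ (h + 1)"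
      unfolding k_def power_mult[symmetric] by (rule arg_cong[of _ _ "power s"]) simp
    also have "\<dots> \<le> n ^ (h + 1)"
      using mono[of "8 * h" "16 * h"] n by (intro power_mono) auto
    finally have "n ^ (h + 1) * (s ^ (4 * h)) ^ k \<le> n ^ (h + 1) * n ^ (h + 1)" by (rule mult_le_mono2)
    also have "\<dots> = n ^ k" unfolding k_def power_add[symmetric] by (simp add: mult_2)
    finally have "s ^ (8 * h) * n ^ k + n ^ (h + 1) * (s ^ (4 * h)) ^ k \<le> (s ^ (8 * h) + 1) * n ^ k"
      by simp
    then have "2 * s ^ k * (s ^ (8 * h) * n ^ k + n ^ (h + 1) * (s ^ (4 * h)) ^ k)
        \<le> 2 * s ^ k * ((s ^ (8 * h) + 1) * n ^ k)" by (rule mult_le_mono2)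
    also have "\<dots> = (2 * s ^ k * (s ^ (8 * h) + 1)) * n ^ k" by (rule mult.assoc[symmetric])
    also have "\<dots> < n * n ^ k"
    proof -
      \<comment> \<open>Here \<open>k\<close> is at most \<open>4 * h\<close> because
        \<open>h\<close> is positive, and the constant 4 is absorbed by one further factor
        \<open>s\<close>, which is at least 8.\<close>
      have "2 * s ^ k * (s ^ (8 * h) + 1) \<le> 2 * s ^ (4 * h) * (2 * s ^ (8 * h))"
        using mono[of k "4 * h"] s1 h by (intro mult_le_mono) (auto simp: k_def Suc_le_eq)
      also have "\<dots> = 4 * s ^ (12 * h)" by (simp add: power_add[symmetric])
      also have "\<dots> < s * s ^ (12 * h)" using s1 by simp
      also have "\<dots> \<le> s ^ (16 * h)" using mono[of "12 * h + 1" "16 * h"] h by simp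
      finally have "2 * s ^ k * (s ^ (8 * h) + 1) < n" using n by linarith
      then show ?thesis using sn s1 by simp
    qed
    also have "\<dots> \<le> (2 * card L) * (s * (e + 1)) ^ k"
      using cL sd by (intro mult_le_mono power_mono) auto
    also have "\<dots> = 2 * s ^ k * (card L * (e + 1) ^ k)" by (simp only: power_mult_distrib mult_ac)
    finally show ?thesis using nat_mult_less_cancel_disj by blast
  qed
  then obtain U where U: "U \<subseteq> V" "s ^ (8 * h) \<le> card U"
    "\<And>ys. length ys = h \<Longrightarrow> set ys \<subseteq> U \<Longrightarrow> s ^ (4 * h) \<le> card (common_nbrs V E (set ys))"
    using dependent_random_choice[OF graph, of L "e + 1" "s ^ (8 * h)" k h "s ^ (4 * h)"]
    unfolding n_def L_def by auto
  have "(4 * t) ^ (2 * h + 1) \<le> s ^ (2 * h + 1)" using s8(1) by (intro power_mono) auto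
  also have "\<dots> \<le> s ^ (4 * h)" using h by (intro mono) simp
  finally have b: "(4 * t) ^ (2 * h + 1) \<le> s ^ (4 * h)" .
  have "h * h * t * (4 * t) ^ (4 * h) \<le> h * h * t * s ^ (4 * h)"
    using s8(1) by (intro mult_le_mono2 power_mono) auto
  also have "\<dots> < s * s ^ (4 * h)" using s8(2) s1 by (intro mult_strict_right_mono) auto
  also have "\<dots> \<le> s ^ (8 * h)" using mono[of "4 * h + 1" "8 * h"] h by simp
  finally have "h * h * t * (4 * t) ^ (4 * h) < card U" using U(2) by linarith
  moreover have "(4 * t) ^ (2 * h + 1) \<le> card U"
    using b mono[of "4 * h" "8 * h"] U(2) by simp
  ultimately show ?thesis
    using U b by (intro bipartite_embedding[OF F h, of U]) (auto intro: order_trans)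
qed

end

section \<open>The constant \<open>c\<close> and the threshold \<open>n0\<close>\<close>

theorem theorem1p8:
  shows "\<exists>c::real. c > 0 \<and>
    (\<forall>(h::nat) (F::nat \<Rightarrow> nat \<Rightarrow> bool).
       simple_graph {0..<h} F \<and> bipartite {0..<h} F \<longrightarrow>
       (\<exists>n0::nat. \<forall>n\<ge>n0. \<forall>E::nat \<Rightarrow> nat \<Rightarrow> bool.
          simple_graph {0..<n} E \<and> \<not> contains_induced {0..<h} F {0..<n} E \<longrightarrow>
          (\<exists>I. independent_set {0..<n} E I \<and> real (card I) \<ge> real n powr (c / real h)) \<or>
          (\<exists>m. contains_Kmm {0..<n} E m \<and> real m \<ge> real n powr (c / real h))))"
proof (intro exI[of _ "1 / 32 :: real"] conjI allI impI)
  fix h :: nat and F :: "nat \<Rightarrow> nat \<Rightarrow> bool"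
  assume F: "simple_graph {0..<h} F \<and> bipartite {0..<h} F"
  show "\<exists>n0::nat. \<forall>n\<ge>n0. \<forall>E::nat \<Rightarrow> nat \<Rightarrow> bool.
          simple_graph {0..<n} E \<and> \<not> contains_induced {0..<h} F {0..<n} E \<longrightarrow>
          (\<exists>I. independent_set {0..<n} E I \<and> real (card I) \<ge> real n powr (1 / 32 / real h)) \<or>
          (\<exists>m. contains_Kmm {0..<n} E m \<and> real m \<ge> real n powr (1 / 32 / real h))"
  proof (intro exI[of _ "(16 * h * h) ^ (32 * h)"] allI impI)
    fix n :: nat and E :: "nat \<Rightarrow> nat \<Rightarrow> bool"
    assume n: "(16 * h * h) ^ (32 * h) \<le> n"
      and E: "simple_graph {0..<n} E \<and> \<not> contains_induced {0..<h} F {0..<n} E"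
    define T where "T = real n powr (1 / 32 / real h)"
    define t where "t = nat \<lceil>T\<rceil>"
    \<comment> \<open>For \<open>h = 0\<close> the empty map is an induced copy, contrary to
      \<open>E\<close>.\<close>
    have h: "0 < h" using E by (cases "h = 0") (auto simp: contains_induced_def)
    then have n1: "1 \<le> n" using n by (metis One_nat_def Suc_leI le_trans mult_pos_pos zero_less_numeral zero_less_power)
    have T1: "1 \<le> T" using n1 h by (simp add: T_def ge_one_powr_ge_zero)
    have Tt: "T \<le> t" "t \<le> 2 * T" "0 < t"
      using T1 unfolding t_def by linarith+
    have "T ^ (32 * h) = n"
      using n1 h by (simp add: T_def powr_realpow[symmetric] powr_powr)
    \<comment> \<open>Rounding up costs at most a factor 2, so \<open>8 * h * h * t\<close> is at
      most \<open>16 * h * h * T\<close>. Squaring the bound wanted by \<open>induced_copy\<close>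
      produces \<open>T ^ (32 * h) = n\<close>, whence the constant \<open>1 / 32\<close>; the other
      factor is exactly the threshold for \<open>n\<close>.\<close>
    have "real ((8 * h * h * t) ^ (16 * h)) ^ 2 = real (8 * h * h * t) ^ (32 * h)"
      by (simp add: power_mult[symmetric] mult_ac)
    also have "\<dots> \<le> (real (16 * h * h) * T) ^ (32 * h)"
    proof (rule power_mono)
      have "real (8 * h * h) * t \<le> real (8 * h * h) * (2 * T)" using Tt(2) by (rule mult_left_mono) simp
      then show "real (8 * h * h * t) \<le> real (16 * h * h) * T" by simp
    qed simp
    also have "\<dots> = real ((16 * h * h) ^ (32 * h)) * n"
      by (subst power_mult_distrib) (simp only: \<open>T ^ (32 * h) = n\<close> of_nat_power)
    also have "\<dots> \<le> real n * real n" using n by (intro mult_right_mono) (simp_all only: of_nat_le_iff of_nat_0_le_iff)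
    finally have "real ((8 * h * h * t) ^ (16 * h)) ^ 2 \<le> real n ^ 2" by (simp add: power2_eq_square)
    then have large: "(8 * h * h * t) ^ (16 * h) \<le> n"
      using power2_le_imp_le[of "real ((8 * h * h * t) ^ (16 * h))" "real n"] by linarith
    show "(\<exists>I. independent_set {0..<n} E I \<and> real (card I) \<ge> real n powr (1 / 32 / real h)) \<or>
          (\<exists>m. contains_Kmm {0..<n} E m \<and> real m \<ge> real n powr (1 / 32 / real h))"
    proof (rule ccontr)
      assume "\<not> ?thesis"
      then have neg: "\<And>I. independent_set {0..<n} E I \<Longrightarrow> real (card I) < T"
        "\<And>m. contains_Kmm {0..<n} E m \<Longrightarrow> real m < T"
        by (auto simp: T_def not_le)
      interpret Kmm_free_graph "{0..<n}" E t
        using E Tt neg(2)[of t] by unfold_locales auto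
      have "card I < t" if "independent_set {0..<n} E I" for I
        using neg(1)[OF that] Tt(1) by linarith
      then have "contains_induced {0..<h} F {0..<n} E"
        using F h large by (intro induced_copy) auto
      then show False using E by blast
    qed
  qed
qed simp

end
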